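(* Let $g$ be a global state, $p,q\in\mathcal{PV}$ and $\Gamma\subseteq\mathcal{A}$. If $\phi\in\{\langle\langle\Gamma\rangle\rangle\mathrm{X}\,p,\ \langle\langle\Gamma\rangle\rangle\mathrm{G}\,p,\ \langle\langle\Gamma\rangle\rangle\,p\,\mathrm{U}\,q\}$, then the predicate $Model_{g,\phi}(\mathcal{V}_M)$ is positive monotonic with respect to $TB_i$ for $i\in\Gamma$.
   Context: Fix a set of agents $\mathcal{A}=\{1,\dots,n\}$, a finite set $\mathcal{PV}$ of propositional variables, and for each agent $i$ a finite set of local states $L_i=\{l_i^1,\dots,l_i^{n_i}\}$. Agent $i$ has actions $Act_i=\{a_i^1,\dots,a_i^{n_i}\}$ and a local protocol $P_i:L_i\to 2^{Act_i}$ with $P_i(l)\neq\emptyset$ for all $l$; its local transition function is $T_i(l_i^k,a_i^j)=l_i^j$, defined iff $a_i^j\in P_i(l_i^k)$. A model is $M=(St,T,V)$ with $St=L_1\times\dots\times L_n$, global actions $Act=Act_1\times\dots\times Act_n$, global transition $T(g,a)=g'$ iff $T_i(g^i,a^i)=g'^i$ for all $i$ (superscript $i$ denotes the $i$-th component), and valuation $V:St\to 2^{\mathcal{PV}}$. Encoding: $P_i$ is a Boolean $n_i\times n_i$ table (entry $(l,a)$ is $1$ iff $a\in P_i(l)$) flattened into $tb_i$; $V$ is a bit vector $vb$ of length $|St|\cdot|\mathcal{PV}|$ (entry $(g,p)$ is $1$ iff $p\in V(g)$). The model is encoded by $v_M=(tb_1,\dots,tb_n,vb)$; $\mathcal{V}_M=(TB_1,\dots,TB_n,VB)$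 is the corresponding vector of Boolean variables; only vectors encoding models (each local state has at least one available action) are considered. A path from $g$ is $g_0a_0g_1a_1\dots$ with $g_0=g$, $T(g_k,a_k)=g_{k+1}$; $\pi[k]=g_k$. A strategy of agent $i$ is $\sigma_i:St\to Act_i$ with $\sigma_i(g)\in P_i(g^i)$; a joint strategy $\sigma_\Gamma$ is a tuple of strategies of agents in $\Gamma$; $out_M(g,\sigma_\Gamma)$ is the set of paths from $g$ with $a_k^j=\sigma_j(g_k)$ for all $k$ and $j\in\Gamma$. $M,g\models\langle\langle\Gamma\rangle\rangle\mathrm{X}\varphi$ iff there is $\sigma_\Gamma$ with $out_M(g,\sigma_\Gamma)\neq\emptyset$ and $M,\pi[1]\models\varphi$ for every $\pi$ in it; $M,g\models\langle\langle\Gamma\rangle\rangle\varphi_1\mathrm{U}\varphi_2$ iff there is $\sigma_\Gamma$ with nonempty outcome such that every $\pi$ in it has $i\ge0$ with $M,\pi[i]\models\varphi_2$ and $M,\pi[j]\models\varphi_1$ for $j<i$; $M,g\models\langle\langle\Gamma\rangle\rangle\mathrm{G}\varphi$ iff there is $\sigma_\Gamma$ with nonempty outcome such that $M,\pi[i]\models\varphi$ for all $i\ge 0$ and all $\pi$ in it; $M,g\models p$ iff $p\in V(g)$. $Model_{g,\phi}(v_M)=1$ iff $M,g\models\phi$ for the model $M$ encoded by $v_M$. A predicate on bit vectors is positive monotonic w.r.t. a set $W$ of its variables if changing any single variable of $W$ from $0$ to $1$ (others fixed) preserves the value $1$. *)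

theory Defs
  imports Main "HOL-Library.FuncSet"
begin

text \<open>Agents are \<open>1, \<dots>, n\<close>. The local state \<open>l_i^k\<close> and the action \<open>a_i^j\<close> of agent \<open>i\<close> are
  represented by their indices \<open>k\<close> and \<open>j\<close>; tuples indexed by agents are extensional functions.\<close>

record 'p signature =
  num_agents :: nat
  num_local :: "nat \<Rightarrow> nat"
  props :: "'p set"

type_synonym gstate = "nat \<Rightarrow> nat"
type_synonym gaction = "nat \<Rightarrow> nat"

definition agents :: "'p signature \<Rightarrow> nat set" where
  "agents S = {1..num_agents S}"

definition Loc :: "'p signature \<Rightarrow> nat \<Rightarrow> nat set" where
  "Loc S i = {1..num_local S i}"

definition Act_loc :: "'p signature \<Rightarrow> nat \<Rightarrow> nat set" where
  "Act_loc S i = {1..num_local S i}"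

definition St :: "'p signature \<Rightarrow> gstate set" where
  "St S = (\<Pi>\<^sub>E i\<in>agents S. Loc S i)"

definition Act :: "'p signature \<Rightarrow> gaction set" where
  "Act S = (\<Pi>\<^sub>E i\<in>agents S. Act_loc S i)"

record 'p model =
  prot :: "nat \<Rightarrow> nat \<Rightarrow> nat set"
  val :: "gstate \<Rightarrow> 'p set"

definition models :: "'p signature \<Rightarrow> 'p model set" where
  "models S = {M. prot M \<in> (\<Pi>\<^sub>E i\<in>agents S. \<Pi>\<^sub>E l\<in>Loc S i. Pow (Act_loc S i) - {{}})
                \<and> val M \<in> (\<Pi>\<^sub>E g\<in>St S. Pow (props S))}"

definition local_trans :: "'p model \<Rightarrow> nat \<Rightarrow> nat \<Rightarrow> nat \<Rightarrow> nat option" where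
  "local_trans M i k j = (if j \<in> prot M i k then Some j else None)"

text \<open>The graph of the (partial) global transition function: \<open>T(g,a) = g'\<close>.\<close>

definition global_trans :: "'p signature \<Rightarrow> 'p model \<Rightarrow> gstate \<Rightarrow> gaction \<Rightarrow> gstate \<Rightarrow> bool" where
  "global_trans S M g a g' \<longleftrightarrow> g \<in> St S \<and> a \<in> Act S \<and> g' \<in> St S
     \<and> (\<forall>i\<in>agents S. local_trans M i (g i) (a i) = Some (g' i))"

text \<open>A path \<open>g\<^sub>0 a\<^sub>0 g\<^sub>1 a\<^sub>1 \<dots>\<close> is the pair of its state sequence and its action sequence.\<close>

type_synonym path = "(nat \<Rightarrow> gstate) \<times> (nat \<Rightarrow> gaction)"

definition paths :: "'p signature \<Rightarrow> 'p model \<Rightarrow> gstate \<Rightarrow> path set" where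
  "paths S M g = {(gs, as). gs 0 = g \<and> (\<forall>k. global_trans S M (gs k) (as k) (gs (Suc k)))}"

definition state_at :: "path \<Rightarrow> nat \<Rightarrow> gstate" where
  "state_at \<pi> k = fst \<pi> k"

definition action_at :: "path \<Rightarrow> nat \<Rightarrow> gaction" where
  "action_at \<pi> k = snd \<pi> k"

type_synonym joint_strategy = "nat \<Rightarrow> gstate \<Rightarrow> nat"

definition strategies :: "'p signature \<Rightarrow> 'p model \<Rightarrow> nat \<Rightarrow> (gstate \<Rightarrow> nat) set" where
  "strategies S M i = (\<Pi>\<^sub>E g\<in>St S. prot M i (g i))"

definition joint_strategies :: "'p signature \<Rightarrow> 'p model \<Rightarrow> nat set \<Rightarrow> joint_strategy set" where
  "joint_strategies S M \<Gamma> = (\<Pi>\<^sub>E i\<in>\<Gamma>. strategies S M i)"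

definition outcome ::
  "'p signature \<Rightarrow> 'p model \<Rightarrow> gstate \<Rightarrow> nat set \<Rightarrow> joint_strategy \<Rightarrow> path set" where
  "outcome S M g \<Gamma> \<sigma> =
     {\<pi> \<in> paths S M g. \<forall>k. \<forall>j\<in>\<Gamma>. action_at \<pi> k j = \<sigma> j (state_at \<pi> k)}"

datatype 'p formula =
    Prop 'p
  | CoalX "nat set" "'p formula"
  | CoalG "nat set" "'p formula"
  | CoalU "nat set" "'p formula" "'p formula"

primrec sat :: "'p signature \<Rightarrow> 'p model \<Rightarrow> gstate \<Rightarrow> 'p formula \<Rightarrow> bool" where
  "sat S M g (Prop p) \<longleftrightarrow> p \<in> val M g"
| "sat S M g (CoalX \<Gamma> \<phi>) \<longleftrightarrow>
     (\<exists>\<sigma>\<in>joint_strategies S M \<Gamma>. outcome S M g \<Gamma> \<sigma> \<noteq> {} \<and>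
        (\<forall>\<pi>\<in>outcome S M g \<Gamma> \<sigma>. sat S M (state_at \<pi> 1) \<phi>))"
| "sat S M g (CoalG \<Gamma> \<phi>) \<longleftrightarrow>
     (\<exists>\<sigma>\<in>joint_strategies S M \<Gamma>. outcome S M g \<Gamma> \<sigma> \<noteq> {} \<and>
        (\<forall>\<pi>\<in>outcome S M g \<Gamma> \<sigma>. \<forall>i. sat S M (state_at \<pi> i) \<phi>))"
| "sat S M g (CoalU \<Gamma> \<phi>1 \<phi>2) \<longleftrightarrow>
     (\<exists>\<sigma>\<in>joint_strategies S M \<Gamma>. outcome S M g \<Gamma> \<sigma> \<noteq> {} \<and>
        (\<forall>\<pi>\<in>outcome S M g \<Gamma> \<sigma>. \<exists>i. sat S M (state_at \<pi> i) \<phi>2 \<and>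
           (\<forall>j<i. sat S M (state_at \<pi> j) \<phi>1)))"

text \<open>Bit vectors are assignments to named Boolean variables: \<open>TBvar i l a\<close> is the entry
  \<open>(l, a)\<close> of the table of agent \<open>i\<close>, and \<open>VBvar g p\<close> is the entry \<open>(g, p)\<close> of the valuation
  vector. Names outside \<open>TB S i\<close> (\<open>i\<close> an agent) and \<open>VB S\<close> are not variables of the encoding;
  they carry the value \<open>False\<close> in every encoding.\<close>

datatype 'p bvar = TBvar nat nat nat | VBvar gstate 'p

definition TB :: "'p signature \<Rightarrow> nat \<Rightarrow> 'p bvar set" where
  "TB S i = {TBvar i l a | l a. l \<in> Loc S i \<and> a \<in> Act_loc S i}"

definition VB :: "'p signature \<Rightarrow> 'p bvar set" where
  "VB S = {VBvar g p | g p. g \<in> St S \<and> p \<in> props S}"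

definition encode :: "'p signature \<Rightarrow> 'p model \<Rightarrow> 'p bvar \<Rightarrow> bool" where
  "encode S M x \<longleftrightarrow> x \<in> (\<Union>i\<in>agents S. TB S i) \<union> VB S \<and>
     (case x of TBvar i l a \<Rightarrow> a \<in> prot M i l | VBvar g p \<Rightarrow> p \<in> val M g)"

lemma encode_inj: "inj_on (encode S) (models S)"
proof (rule inj_onI)
  fix M N :: "'a model"
  assume M: "M \<in> models S" and N: "N \<in> models S" and e: "encode S M = encode S N"
  have T: "a \<in> prot M i l \<longleftrightarrow> a \<in> prot N i l"
    if "i \<in> agents S" "l \<in> Loc S i" "a \<in> Act_loc S i" for i l a
    using fun_cong[OF e, of "TBvar i l a"] that by (auto simp: encode_def TB_def)
  have V: "p \<in> val M g \<longleftrightarrow> p \<in> val N g" if "g \<in> St S" "p \<in> props S" for g p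
    using fun_cong[OF e, of "VBvar g p"] that by (auto simp: encode_def VB_def)
  have "prot M i l = prot N i l" if "i \<in> agents S" "l \<in> Loc S i" for i l
  proof -
    have "prot M i l \<subseteq> Act_loc S i" "prot N i l \<subseteq> Act_loc S i"
      using M N that by (auto simp: models_def PiE_iff)
    then show ?thesis using T[OF that] by blast
  qed
  then have "prot M i = prot N i" if "i \<in> agents S" for i
    using M N that
    by (auto simp: models_def PiE_iff intro!: extensionalityI[of _ "Loc S i"])
  then have P: "prot M = prot N"
    using M N by (rule_tac extensionalityI[of _ "agents S"]) (auto simp: models_def PiE_iff)
  have "val M g = val N g" if "g \<in> St S" for g
  proof -
    have "val M g \<subseteq> props S" "val N g \<subseteq> props S"
      using M N that by (auto simp: models_def PiE_iff)
    then show ?thesis using V[OF that] by blast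
  qed
  then have "val M = val N"
    using M N by (auto simp: models_def PiE_iff intro!: extensionalityI[of _ "St S"])
  with P show "M = N" by simp
qed

text \<open>By injectivity of the encoding, the model in the following existential is the unique one
  encoded by \<open>v\<close>.\<close>

definition Model :: "'p signature \<Rightarrow> gstate \<Rightarrow> 'p formula \<Rightarrow> ('p bvar \<Rightarrow> bool) \<Rightarrow> bool" where
  "Model S g \<phi> v \<longleftrightarrow> (\<exists>M\<in>models S. encode S M = v \<and> sat S M g \<phi>)"

definition positive_monotonic :: "(('x \<Rightarrow> bool) \<Rightarrow> bool) \<Rightarrow> 'x set \<Rightarrow> bool" where
  "positive_monotonic F W \<longleftrightarrow> (\<forall>v. \<forall>w\<in>W. \<not> v w \<longrightarrow> F v \<longrightarrow> F (v(w := True)))"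

end

theory Submission
  imports Defs
begin

text \<open>Enlarging the protocols of agents in \<open>\<Gamma>\<close> keeps every joint strategy of \<open>\<Gamma>\<close> legal. Under such
  a strategy the agents in \<open>\<Gamma>\<close> never use the added actions, and the choices of the
  other agents are unchanged, so the outcome is literally the same set of paths.\<close>

definition add_action :: "nat \<Rightarrow> nat \<Rightarrow> nat \<Rightarrow> 'p model \<Rightarrow> 'p model" where
  "add_action i l a M = M\<lparr>prot := (prot M)(i := (prot M i)(l := insert a (prot M i l)))\<rparr>"

lemma val_add_action [simp]: "val (add_action i l a M) = val M"
  by (simp add: add_action_def)

lemma prot_add_action:
  "prot (add_action i l a M) j k = (if j = i \<and> k = l then insert a (prot M i l) else prot M j k)"
  by (simp add: add_action_def)

text \<open>Insertion cannot empty a protocol entry, and the range conditions on \<open>i\<close>,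
  \<open>l\<close> and \<open>a\<close> keep the table extensional and within
  \<open>Act_loc\<close>.\<close>

lemma add_action_in_models:
  assumes "M \<in> models S" "i \<in> agents S" "l \<in> Loc S i" "a \<in> Act_loc S i"
  shows "add_action i l a M \<in> models S"
  using assms by (auto simp: models_def add_action_def PiE_iff extensional_def)

text \<open>Turns a bit flip in the table of agent \<open>i\<close> into an operation on models, so
  that the flipped vector can be decoded.\<close>

lemma encode_add_action:
  assumes "i \<in> agents S" "l \<in> Loc S i" "a \<in> Act_loc S i"
  shows "encode S (add_action i l a M) = (encode S M)(TBvar i l a := True)"
proof
  fix x show "encode S (add_action i l a M) x = ((encode S M)(TBvar i l a := True)) x"
    using assms by (cases x) (auto simp: encode_def TB_def prot_add_action)
qed

lemma joint_strategies_mono: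
  assumes "\<And>j k. j \<in> \<Gamma> \<Longrightarrow> prot M j k \<subseteq> prot N j k"
  shows "joint_strategies S M \<Gamma> \<subseteq> joint_strategies S N \<Gamma>"
  unfolding joint_strategies_def strategies_def
  using assms by (intro PiE_mono) blast

text \<open>Both inclusions matter: no path may be lost, to keep the outcome nonempty, and none may
  be gained, to keep a property of all its paths.\<close>

lemma outcome_cong_protocol:
  assumes \<sigma>: "\<sigma> \<in> joint_strategies S M \<Gamma>"
    and le: "\<And>j k. j \<in> \<Gamma> \<Longrightarrow> prot M j k \<subseteq> prot N j k"
    and eq: "\<And>j k. j \<notin> \<Gamma> \<Longrightarrow> prot M j k = prot N j k"
  shows "outcome S N g \<Gamma> \<sigma> = outcome S M g \<Gamma> \<sigma>"
proof -
  have step: "global_trans S N h b h' \<longleftrightarrow> global_trans S M h b h'"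
    if b: "\<forall>j\<in>\<Gamma>. b j = \<sigma> j h" for h b h'
  \<comment> \<open>Strategies are constrained only on \<open>St S\<close>; elsewhere
    \<open>global_trans\<close> is false for both models.\<close>
  proof (cases "h \<in> St S")
    case True
    have "b j \<in> prot N j (h j) \<longleftrightarrow> b j \<in> prot M j (h j)" for j
    proof (cases "j \<in> \<Gamma>")
      case j: True
      \<comment> \<open>For \<open>j\<close> in \<Gamma> both memberships are true: the action
        prescribed by \<sigma> is already legal in \<open>M\<close>, hence also in
        \<open>N\<close>.\<close>
      with \<sigma> True b have "b j \<in> prot M j (h j)"
        by (auto simp: joint_strategies_def strategies_def PiE_iff)
      with le[OF j] show ?thesis by blast
    qed (simp add: eq)
    then show ?thesis by (simp add: global_trans_def local_trans_def)
  qed (simp add: global_trans_def)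
  show ?thesis
    unfolding outcome_def paths_def action_at_def state_at_def using step by fastforce
qed

theorem theorem3p6:
  fixes S :: "'p signature" and g :: gstate and p q :: 'p and \<Gamma> :: "nat set"
    and \<phi> :: "'p formula"
  assumes "finite (props S)"
    and "g \<in> St S"
    and "p \<in> props S" and "q \<in> props S"
    and "\<Gamma> \<subseteq> agents S"
    and "\<phi> \<in> {CoalX \<Gamma> (Prop p), CoalG \<Gamma> (Prop p), CoalU \<Gamma> (Prop p) (Prop q)}"
  shows "\<forall>i\<in>\<Gamma>. positive_monotonic (Model S g \<phi>) (TB S i)"
  unfolding positive_monotonic_def
proof (intro ballI allI impI)
  fix i v w
  assume i: "i \<in> \<Gamma>" and w: "w \<in> TB S i" and "Model S g \<phi> v"
  then obtain M where M: "M \<in> models S" "encode S M = v" "sat S M g \<phi>"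
    by (auto simp: Model_def)
  from w obtain l a where la: "w = TBvar i l a" "l \<in> Loc S i" "a \<in> Act_loc S i"
    by (auto simp: TB_def)
  have ag: "i \<in> agents S" using i assms(5) by blast
  let ?N = "add_action i l a M"
  have le: "prot M j k \<subseteq> prot ?N j k" for j k
    by (auto simp: prot_add_action)
  have eq: "prot M j k = prot ?N j k" if "j \<notin> \<Gamma>" for j k
    using that i by (auto simp: prot_add_action)
  \<comment> \<open>The three modalities differ only in the path property, so \<open>Q\<close> is
    left arbitrary; it must be the same predicate for \<open>M\<close> and
    \<open>?N\<close>.\<close>
  have transfer: "\<exists>\<sigma>\<in>joint_strategies S ?N \<Gamma>. outcome S ?N g \<Gamma> \<sigma> \<noteq> {} \<and> (\<forall>\<pi>\<in>outcome S ?N g \<Gamma> \<sigma>. Q \<pi>)"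
    if "\<exists>\<sigma>\<in>joint_strategies S M \<Gamma>. outcome S M g \<Gamma> \<sigma> \<noteq> {} \<and> (\<forall>\<pi>\<in>outcome S M g \<Gamma> \<sigma>. Q \<pi>)" for Q
  proof -
    from that obtain \<sigma> where \<sigma>: "\<sigma> \<in> joint_strategies S M \<Gamma>"
      and Q: "outcome S M g \<Gamma> \<sigma> \<noteq> {} \<and> (\<forall>\<pi>\<in>outcome S M g \<Gamma> \<sigma>. Q \<pi>)" by (elim bexE)
    have "\<sigma> \<in> joint_strategies S ?N \<Gamma>"
      by (rule subsetD[OF joint_strategies_mono[OF le] \<sigma>])
    moreover have "outcome S ?N g \<Gamma> \<sigma> = outcome S M g \<Gamma> \<sigma>"
      by (rule outcome_cong_protocol[OF \<sigma> le eq])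
    ultimately show ?thesis using Q by (intro bexI[of _ \<sigma>]) simp_all
  qed
  from assms(6) consider "\<phi> = CoalX \<Gamma> (Prop p)" | "\<phi> = CoalG \<Gamma> (Prop p)"
    | "\<phi> = CoalU \<Gamma> (Prop p) (Prop q)" by blast
  then have "sat S ?N g \<phi>"
  proof cases
    case 1
    \<comment> \<open>The arguments of the modality are propositions, whose truth depends only on
      \<open>val\<close>; rewriting with \<open>val_add_action\<close> thus yields one
      \<open>Q\<close> for both models.\<close>
    show ?thesis using M(3) unfolding 1 sat.simps val_add_action by (rule transfer)
  next
    case 2
    show ?thesis using M(3) unfolding 2 sat.simps val_add_action by (rule transfer)
  next
    case 3
    show ?thesis using M(3) unfolding 3 sat.simps val_add_action by (rule transfer)
  qed
  then show "Model S g \<phi> (v(w := True))"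
    using add_action_in_models[OF M(1) ag la(2,3)] encode_add_action[OF ag la(2,3), of M] M(2) la(1)
    by (auto simp: Model_def)
qed

end
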